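(* Let $p=\frac{3\log n}{\sqrt n}$ and $q=\frac{\log n}{\sqrt n}$, and let $G\sim G(2n,2,p,q)$ be a random graph from the planted partition model with two clusters of $n$ vertices each. For each edge $(u,v)$ of $G$ let $t(u,v)$ be the number of triangles of $G$ containing $(u,v)$. Then with high probability (i.e., with probability tending to $1$ as $n\to\infty$) every edge $(u,v)$ of $G$ with both endpoints in the same cluster satisfies $t(u,v)\ge 8\log^2 n$, every edge $(u,v)$ of $G$ with endpoints in different clusters satisfies $t(u,v)\le 8\log^2 n$, and removing from $G$ all edges $(u,v)$ with $t(u,v)<8\log^2 n$ recovers the two clusters, i.e., the connected components of the resulting graph are exactly the two clusters.
   Context: Planted partition model $G(2n,2,p,q)$: the vertex set has $2n$ vertices partitioned into $2$ clusters of exactly $n$ vertices each. Each pair of distinct vertices is joined by an edge independently, with probability $p$ if both vertices are in the same cluster and with probability $q$ otherwise. Here $n$ is large enough that $p\le 1$, and $\log$ is the natural logarithm. *)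

theory Defs
  imports "HOL-Probability.Probability" "HOL-Probability.Product_PMF" "HOL-Library.Disjoint_Sets"
begin

text \<open>
  A simple graph on a vertex set is given by its set of edges, each edge being a
  two-element set of vertices.
\<close>

definition vertex_pairs :: "'a set \<Rightarrow> 'a set set" where
  "vertex_pairs V = {{u, v} | u v. u \<in> V \<and> v \<in> V \<and> u \<noteq> v}"

definition cluster_partition :: "nat \<Rightarrow> nat \<Rightarrow> 'a set \<Rightarrow> 'a set set \<Rightarrow> bool" where
  "cluster_partition n k V C \<longleftrightarrow>
     finite V \<and> partition_on V C \<and> card C = k \<and> (\<forall>c\<in>C. card c = n)"

definition same_cluster :: "'a set set \<Rightarrow> 'a \<Rightarrow> 'a \<Rightarrow> bool" where
  "same_cluster C u v \<longleftrightarrow> (\<exists>c\<in>C. u \<in> c \<and> v \<in> c)"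

text \<open>
  The random edge set of \<open>G(nk, k, p, q)\<close>, for vertex set \<open>V\<close> and set of clusters \<open>C\<close>.
  The parameter of \<^const>\<open>bernoulli_pmf\<close> is implicitly clamped to the unit interval.
\<close>

definition planted_partition ::
    "'a set \<Rightarrow> 'a set set \<Rightarrow> real \<Rightarrow> real \<Rightarrow> 'a set set pmf" where
  "planted_partition V C p q =
     map_pmf (\<lambda>f. {e \<in> vertex_pairs V. f e})
       (Pi_pmf (vertex_pairs V) False
         (\<lambda>e. bernoulli_pmf (if \<exists>c\<in>C. e \<subseteq> c then p else q)))"

definition triangles :: "'a set set \<Rightarrow> 'a set set" where
  "triangles E = {T. card T = 3 \<and> (\<forall>u\<in>T. \<forall>v\<in>T. u \<noteq> v \<longrightarrow> {u, v} \<in> E)}"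

definition triangle_count :: "'a set set \<Rightarrow> 'a \<Rightarrow> 'a \<Rightarrow> nat" where
  "triangle_count E u v = card {T \<in> triangles E. u \<in> T \<and> v \<in> T}"

definition connected_components :: "'a set \<Rightarrow> 'a set set \<Rightarrow> 'a set set" where
  "connected_components V E =
     V // {(u, v). u \<in> V \<and> v \<in> V \<and> (u, v) \<in> {(x, y). {x, y} \<in> E}\<^sup>*}"

end

theory Submission
  imports Defs "HOL-Real_Asymp.Real_Asymp"
begin

text \<open>
  Given that \<open>u\<close> and \<open>v\<close> are adjacent, the number of triangles on the edge is the number of common
  neighbours, a sum of independent indicators. With \<open>L = ln n\<close>, its mean is
  \<open>(n - 2) p\<^sup>2 + n q\<^sup>2 \<approx> 10 L\<^sup>2\<close> inside a cluster and \<open>2 (n - 1) p q \<approx> 6 L\<^sup>2\<close> across clusters, so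
  Chernoff bounds place it on the correct side of \<open>8 L\<^sup>2\<close> except with probability
  \<open>exp (- \<Omega>(L\<^sup>2))\<close>, which survives a union bound over the \<open>O(n\<^sup>2)\<close> pairs. The same bound shows that
  any two vertices of a cluster have a common neighbour in that cluster, so that the
  clusters stay connected after the pruning.
\<close>

section \<open>Common neighbours and triangles\<close>

text \<open>The set \<open>W\<close> is a parameter because counts are taken over all of
  \<open>V\<close> for the threshold and over a single cluster for connectivity.\<close>

definition common_neighbours :: "'a set set \<Rightarrow> 'a set \<Rightarrow> 'a \<Rightarrow> 'a \<Rightarrow> 'a set" where
  "common_neighbours E W u v = {w \<in> W. {u, w} \<in> E \<and> {v, w} \<in> E}"

lemma finite_vertex_pairs: "finite V \<Longrightarrow> finite (vertex_pairs V)"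
  by (rule finite_subset[of _ "Pow V"]) (auto simp: vertex_pairs_def)

lemma doubleton_in_vertex_pairs: "{u, v} \<in> vertex_pairs V \<longleftrightarrow> u \<in> V \<and> v \<in> V \<and> u \<noteq> v"
  by (auto simp: vertex_pairs_def doubleton_eq_iff)

text \<open>A triangle on the edge is determined by its third vertex, so \<open>w\<close> \<mapsto>
  \<open>{u, v, w}\<close> is a bijection. That \<open>E\<close> consists of vertex pairs excludes
  loops and places the third vertex in \<open>V\<close>.\<close>

lemma triangle_count_eq_card_common_neighbours:
  assumes E: "E \<subseteq> vertex_pairs V" and uv: "{u, v} \<in> E"
  shows "triangle_count E u v = card (common_neighbours E (V - {u, v}) u v)"
proof -
  have loop: "{x} \<notin> E" for x
    using subsetD[OF E, of "{x, x}"] doubleton_in_vertex_pairs[of x x V] by auto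
  have mem: "x \<in> V" if "{x, y} \<in> E" for x y
    using subsetD[OF E that] by (simp add: doubleton_in_vertex_pairs)
  have ne: "u \<noteq> v"
    using loop uv by auto
  let ?N = "common_neighbours E (V - {u, v}) u v"
  have "{T \<in> triangles E. u \<in> T \<and> v \<in> T} = (\<lambda>w. {u, v, w}) ` ?N"
  proof (intro equalityI subsetI)
    fix T assume "T \<in> {T \<in> triangles E. u \<in> T \<and> v \<in> T}"
    then have T: "card T = 3" "\<forall>x\<in>T. \<forall>y\<in>T. x \<noteq> y \<longrightarrow> {x, y} \<in> E" "u \<in> T" "v \<in> T"
      by (auto simp: triangles_def)
    have "card (T - {u, v}) = 1"
      using T ne by (simp add: card_Diff_subset)
    then obtain w where w: "T - {u, v} = {w}"
      by (auto simp: card_1_singleton_iff)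
    then have "T = {u, v, w}" "w \<noteq> u" "w \<noteq> v"
      using T by auto
    moreover from this T have "{u, w} \<in> E" "{v, w} \<in> E"
      by auto
    moreover from this mem[of w u] have "w \<in> V"
      by (simp add: insert_commute)
    ultimately show "T \<in> (\<lambda>w. {u, v, w}) ` ?N"
      by (auto simp: common_neighbours_def)
  next
    fix T assume "T \<in> (\<lambda>w. {u, v, w}) ` ?N"
    then show "T \<in> {T \<in> triangles E. u \<in> T \<and> v \<in> T}"
      using ne uv by (auto simp: triangles_def common_neighbours_def insert_commute)
  qed
  moreover have "inj_on (\<lambda>w. {u, v, w}) ?N"
    by (auto simp: inj_on_def common_neighbours_def)
  ultimately show ?thesis
    by (simp add: triangle_count_def card_image)
qed

lemma triangle_count_commute: "triangle_count E u v = triangle_count E v u"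
  by (simp add: triangle_count_def conj_commute)

section \<open>Generating function and Chernoff bound\<close>

text \<open>The event is a box in the product space, so its probability factorises over the
  coordinates; those outside \<open>F\<close> are unconstrained and contribute 1.\<close>

lemma prob_all_edges_Pi_pmf:
  assumes "finite A" "F \<subseteq> A" "\<And>e. e \<in> F \<Longrightarrow> 0 \<le> pr e \<and> pr e \<le> 1"
  shows "measure_pmf.prob (Pi_pmf A False (\<lambda>e. bernoulli_pmf (pr e))) {f. \<forall>e\<in>F. f e}
       = (\<Prod>e\<in>F. pr e)"
proof -
  have "{f. \<forall>e\<in>F. f e} = Pi A (\<lambda>e. if e \<in> F then {True} else UNIV)"
    using assms(2) by (auto simp: Pi_def split: if_splits)
  then have "measure_pmf.prob (Pi_pmf A False (\<lambda>e. bernoulli_pmf (pr e))) {f. \<forall>e\<in>F. f e}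
     = (\<Prod>e\<in>A. measure_pmf.prob (bernoulli_pmf (pr e)) (if e \<in> F then {True} else UNIV))"
    by (simp add: measure_Pi_pmf_Pi assms(1))
  also have "\<dots> = (\<Prod>e\<in>A. if e \<in> F then pr e else 1)"
    by (intro prod.cong) (auto simp: measure_pmf_single assms(3))
  also have "\<dots> = (\<Prod>e\<in>F. pr e)"
    using assms(1,2) by (simp add: prod.If_cases Int_absorb1)
  finally show ?thesis .
qed

text \<open>Writing each factor as 1 or \<open>(s - 1) + 1\<close> expands the power into a sum over
  subsets \<open>S\<close> of \<open>W\<close>. Each term then only involves the probability that
  all edges from \<open>u\<close> and \<open>v\<close> to \<open>S\<close> are present, which
  factorises, and the sum folds back into a product.\<close>

lemma expectation_power_common_neighbours:
  fixes s :: real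
  assumes V: "finite V" "u \<in> V" "v \<in> V" "u \<noteq> v" "W \<subseteq> V - {u, v}"
    and pr: "\<And>e. 0 \<le> pr e \<and> pr e \<le> 1"
  shows "measure_pmf.expectation (Pi_pmf (vertex_pairs V) False (\<lambda>e. bernoulli_pmf (pr e)))
           (\<lambda>f. s ^ card (common_neighbours {e. f e} W u v))
       = (\<Prod>w\<in>W. 1 + (s - 1) * pr {u, w} * pr {v, w})"
proof -
  let ?M = "Pi_pmf (vertex_pairs V) False (\<lambda>e. bernoulli_pmf (pr e))"
  have finW: "finite W"
    using V finite_subset by blast
  have finM: "finite (set_pmf ?M)"
    by (auto simp: set_Pi_pmf finite_vertex_pairs V(1))
  define ev where "ev S = {f. \<forall>e\<in>(\<lambda>w. {u, w}) ` S \<union> (\<lambda>w. {v, w}) ` S. f e}" for S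
  have expand: "s ^ card (common_neighbours {e. f e} W u v)
      = (\<Sum>S\<in>Pow W. (s - 1) ^ card S * indicator (ev S) f)" for f
  proof -
    have "s ^ card (common_neighbours {e. f e} W u v)
        = (\<Prod>w\<in>W. if f {u, w} \<and> f {v, w} then s else 1)"
      using finW by (simp add: prod.If_cases common_neighbours_def Int_def)
    also have "\<dots> = (\<Prod>w\<in>W. (s - 1) * of_bool (f {u, w} \<and> f {v, w}) + 1)"
      by (intro prod.cong) auto
    also have "\<dots> = (\<Sum>S\<in>Pow W. \<Prod>w\<in>S. (s - 1) * of_bool (f {u, w} \<and> f {v, w}))"
      using finW by (simp add: prod_add)
    also have "\<dots> = (\<Sum>S\<in>Pow W. (s - 1) ^ card S * indicator (ev S) f)"
    proof (intro sum.cong refl)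
      fix S assume "S \<in> Pow W"
      then have "finite S"
        using finW finite_subset by blast
      then have "(\<Prod>w\<in>S. of_bool (f {u, w} \<and> f {v, w}) :: real) = indicator (ev S) f"
        by (induction S rule: finite_induct) (auto simp: ev_def indicator_def)
      then show "(\<Prod>w\<in>S. (s - 1) * of_bool (f {u, w} \<and> f {v, w}))
          = (s - 1) ^ card S * indicator (ev S) f"
        by (simp add: prod.distrib)
    qed
    finally show ?thesis .
  qed
  have prob_ev: "measure_pmf.prob ?M (ev S) = (\<Prod>w\<in>S. pr {u, w} * pr {v, w})" if "S \<subseteq> W" for S
  proof -
    have S: "finite S" "S \<subseteq> V - {u, v}"
      using that V finW finite_subset by blast+
    have "measure_pmf.prob ?M (ev S) = (\<Prod>e\<in>(\<lambda>w. {u, w}) ` S \<union> (\<lambda>w. {v, w}) ` S. pr e)"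
      unfolding ev_def
      by (rule prob_all_edges_Pi_pmf)
         (use S V pr in \<open>auto simp: finite_vertex_pairs doubleton_in_vertex_pairs\<close>)
    \<comment> \<open>The stars from \<open>u\<close> and from \<open>v\<close> to \<open>S\<close>
      share no edge, because \<open>u\<close> \<noteq> \<open>v\<close> and \<open>S\<close> avoids
      both.\<close>
    also have "\<dots> = (\<Prod>e\<in>(\<lambda>w. {u, w}) ` S. pr e) * (\<Prod>e\<in>(\<lambda>w. {v, w}) ` S. pr e)"
      using S V by (intro prod.union_disjoint) (auto simp: doubleton_eq_iff)
    also have "\<dots> = (\<Prod>w\<in>S. pr {u, w}) * (\<Prod>w\<in>S. pr {v, w})"
      using S by (subst (1 2) prod.reindex) (auto simp: inj_on_def doubleton_eq_iff)
    finally show ?thesis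
      by (simp add: prod.distrib)
  qed
  have "measure_pmf.expectation ?M (\<lambda>f. s ^ card (common_neighbours {e. f e} W u v))
      = (\<Sum>S\<in>Pow W. (s - 1) ^ card S * measure_pmf.prob ?M (ev S))"
    unfolding expand by (subst Bochner_Integration.integral_sum)
      (auto intro: integrable_measure_pmf_finite finM)
  also have "\<dots> = (\<Sum>S\<in>Pow W. \<Prod>w\<in>S. (s - 1) * pr {u, w} * pr {v, w})"
    by (intro sum.cong refl) (auto simp: prob_ev prod.distrib)
  also have "\<dots> = (\<Prod>w\<in>W. (s - 1) * pr {u, w} * pr {v, w} + 1)"
    using finW by (simp add: prod_add)
  finally show ?thesis
    by (simp add: add.commute)
qed

text \<open>
  Both Chernoff tails at once: multiplying by \<open>ln s\<close> makes the event an upper tail for \<open>s > 1\<close> and a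
  lower tail for \<open>s < 1\<close>.
\<close>

lemma chernoff_common_neighbours:
  fixes s a :: real
  assumes V: "finite V" "u \<in> V" "v \<in> V" "u \<noteq> v" "W \<subseteq> V - {u, v}"
    and pr: "\<And>e. 0 \<le> pr e \<and> pr e \<le> 1" and s: "0 < s"
  shows "measure_pmf.prob (Pi_pmf (vertex_pairs V) False (\<lambda>e. bernoulli_pmf (pr e)))
           {f. a * ln s \<le> real (card (common_neighbours {e. f e} W u v)) * ln s}
       \<le> exp ((s - 1) * (\<Sum>w\<in>W. pr {u, w} * pr {v, w}) - a * ln s)"
proof -
  let ?M = "Pi_pmf (vertex_pairs V) False (\<lambda>e. bernoulli_pmf (pr e))"
  let ?X = "\<lambda>f. card (common_neighbours {e. f e} W u v)"
  have finM: "finite (set_pmf ?M)"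
    by (auto simp: set_Pi_pmf finite_vertex_pairs V(1))
  have eq: "s ^ k = exp (real k * ln s)" for k
    using s by (simp add: exp_of_nat_mult)
  have "measure_pmf.prob ?M {f. a * ln s \<le> real (?X f) * ln s}
      = measure ?M {f \<in> space ?M. exp (a * ln s) \<le> s ^ ?X f}"
    by (simp add: eq)
  also have "\<dots> \<le> measure_pmf.expectation ?M (\<lambda>f. s ^ ?X f) / exp (a * ln s)"
    by (rule integral_Markov_inequality_measure[where A = UNIV])
       (use s in \<open>auto intro: integrable_measure_pmf_finite finM\<close>)
  also have "measure_pmf.expectation ?M (\<lambda>f. s ^ ?X f)
      = (\<Prod>w\<in>W. 1 + (s - 1) * pr {u, w} * pr {v, w})"
    by (rule expectation_power_common_neighbours[OF V pr])
  also have "\<dots> \<le> (\<Prod>w\<in>W. exp ((s - 1) * (pr {u, w} * pr {v, w})))"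
  proof (rule prod_mono, intro conjI)
    fix w
    have "0 \<le> pr {u, w} * pr {v, w}" "pr {u, w} * pr {v, w} \<le> 1"
      using pr by (auto intro: mult_le_one)
    \<comment> \<open>The factor is a convex combination of \<open>s\<close> and 1, hence
      nonnegative even for \<open>s\<close> < 1, where \<open>s - 1\<close> is negative.\<close>
    then have "0 \<le> s * (pr {u, w} * pr {v, w}) + (1 - pr {u, w} * pr {v, w})"
      using s by simp
    then show "0 \<le> 1 + (s - 1) * pr {u, w} * pr {v, w}"
      by (simp add: algebra_simps)
    show "1 + (s - 1) * pr {u, w} * pr {v, w} \<le> exp ((s - 1) * (pr {u, w} * pr {v, w}))"
      using exp_ge_add_one_self[of "(s - 1) * (pr {u, w} * pr {v, w})"] by (simp add: mult.assoc)
  qed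
  also have "\<dots> = exp ((s - 1) * (\<Sum>w\<in>W. pr {u, w} * pr {v, w}))"
    using finite_subset[OF V(5)] V(1) by (simp add: exp_sum sum_distrib_left)
  finally show ?thesis
    by (simp add: exp_diff divide_right_mono)
qed

section \<open>Deterministic recovery of the clusters\<close>

text \<open>All pairs are constrained, adjacent or not, so that no conditioning on the presence of
  an edge arises. The bound across clusters is strict so that those edges are really removed. The
  nonemptiness clause, with the neighbour in the cluster itself, is what gives connectivity.\<close>

definition well_separated :: "'a set \<Rightarrow> 'a set set \<Rightarrow> real \<Rightarrow> 'a set set \<Rightarrow> bool" where
  "well_separated V C t E \<longleftrightarrow>
     (\<forall>c\<in>C. \<forall>u\<in>c. \<forall>v\<in>c. u \<noteq> v \<longrightarrow>
        t \<le> real (card (common_neighbours E (V - {u, v}) u v)) \<and>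
        common_neighbours E (c - {u, v}) u v \<noteq> {}) \<and>
     (\<forall>u\<in>V. \<forall>v\<in>V. \<not> same_cluster C u v \<longrightarrow>
        real (card (common_neighbours E (V - {u, v}) u v)) < t)"

lemma triangle_count_of_well_separated:
  assumes "E \<subseteq> vertex_pairs V" "well_separated V C t E" "{u, v} \<in> E"
  shows "t \<le> real (triangle_count E u v) \<longleftrightarrow> same_cluster C u v"
proof -
  have "u \<in> V" "v \<in> V" "u \<noteq> v"
    using subsetD[OF assms(1,3)] by (simp_all add: doubleton_in_vertex_pairs)
  then show ?thesis
    using assms triangle_count_eq_card_common_neighbours[OF assms(1,3)]
    unfolding well_separated_def same_cluster_def by (metis leD)
qed

text \<open>Exactly the edges inside clusters survive the pruning. Hence no path leaves a cluster,
  and two distinct vertices of a cluster are joined by a path of length two through a common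
  neighbour in that cluster.\<close>

lemma connected_components_of_well_separated:
  assumes C: "partition_on V C" and E: "E \<subseteq> vertex_pairs V" and sep: "well_separated V C t E"
  shows "connected_components V
           (E - {{u, v} | u v. {u, v} \<in> E \<and> real (triangle_count E u v) < t}) = C"
proof -
  define E' where "E' = E - {{u, v} | u v. {u, v} \<in> E \<and> real (triangle_count E u v) < t}"
  have E'_iff: "{x, y} \<in> E' \<longleftrightarrow> {x, y} \<in> E \<and> same_cluster C x y" for x y
  proof -
    have "{x, y} \<in> E' \<longleftrightarrow> {x, y} \<in> E \<and> t \<le> real (triangle_count E x y)"
      \<comment> \<open>The removed edges are unordered pairs, so the witnesses may appear in either
        order; symmetry of the count covers both.\<close>
      unfolding E'_def using triangle_count_commute[of E]
      by (auto simp: doubleton_eq_iff not_less)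
    then show ?thesis
      using triangle_count_of_well_separated[OF E sep] by blast
  qed
  let ?R = "{(x, y). {x, y} \<in> E'}"
  have disj: "c = d" if "c \<in> C" "d \<in> C" "x \<in> c" "x \<in> d" for c d x
    using C that by (auto simp: partition_on_def disjoint_def)
  have stay: "y \<in> c" if "(x, y) \<in> ?R\<^sup>*" "c \<in> C" "x \<in> c" for x y c
    using that(1)
  proof induction
    case base
    then show ?case using that by simp
  next
    case (step y z)
    then show ?case
      using disj that(2) by (auto simp: E'_iff same_cluster_def)
  qed
  have reach: "(u, v) \<in> ?R\<^sup>*" if "c \<in> C" "u \<in> c" "v \<in> c" for u v c
  proof (cases "u = v")
    case False
    then have "common_neighbours E (c - {u, v}) u v \<noteq> {}"
      using sep that by (simp add: well_separated_def)
    then obtain w where "w \<in> c" "{u, w} \<in> E" "{v, w} \<in> E"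
      by (auto simp: common_neighbours_def)
    then have "(u, w) \<in> ?R" "(w, v) \<in> ?R"
      using that by (auto simp: E'_iff same_cluster_def insert_commute)
    then show ?thesis
      by (meson r_into_rtrancl rtrancl_trans)
  qed simp
  have "{(u, v). u \<in> V \<and> v \<in> V \<and> (u, v) \<in> ?R\<^sup>*} = {(u, v). \<exists>c\<in>C. u \<in> c \<and> v \<in> c}"
  proof (intro equalityI subsetI; clarify)
    fix x y assume "x \<in> V" "(x, y) \<in> ?R\<^sup>*"
    moreover from this obtain c where "c \<in> C" "x \<in> c"
      using partition_onD1[OF C] by blast
    ultimately show "\<exists>c\<in>C. x \<in> c \<and> y \<in> c"
      using stay by blast
  next
    fix x y c assume "c \<in> C" "x \<in> c" "y \<in> c"
    then show "x \<in> V \<and> y \<in> V \<and> (x, y) \<in> ?R\<^sup>*"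
      using reach partition_onD1[OF C] by blast
  qed
  then show ?thesis
    using partition_on_eq_quotient[OF C]
    unfolding connected_components_def E'_def[symmetric] by simp
qed

section \<open>Edge probabilities and means for two clusters\<close>

text \<open>The bound 100 makes the \<open>1 / n\<close> corrections of the means small enough for
  the Chernoff exponents; the second inequality is \<open>p\<close> \<le> 1, so that no Bernoulli
  parameter is clamped.\<close>

locale planted_bisection =
  fixes n :: nat and V :: "'a set" and C :: "'a set set"
  assumes clusters: "cluster_partition n 2 V C"
    and n_large: "100 \<le> n" "3 * ln (real n) / sqrt (real n) \<le> 1"
begin

definition p :: real where "p = 3 * ln (real n) / sqrt (real n)"
definition q :: real where "q = ln (real n) / sqrt (real n)"
definition pr :: "'a set \<Rightarrow> real" where "pr e = (if \<exists>c\<in>C. e \<subseteq> c then p else q)"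
abbreviation M :: "('a set \<Rightarrow> bool) pmf" where
  "M \<equiv> Pi_pmf (vertex_pairs V) False (\<lambda>e. bernoulli_pmf (pr e))"
text \<open>A common bound for all three kinds of bad event. The rate 1/25 is dictated by the
  tightest of them, the lower tail inside a cluster. The square of the logarithm makes it smaller
  than any fixed negative power of \<open>n\<close> for large \<open>n\<close>.\<close>

definition \<delta> :: real where "\<delta> = exp (- (ln (real n))\<^sup>2 / 25)"

lemma finite_V: "finite V"
  using clusters by (simp add: cluster_partition_def)

lemma partition: "partition_on V C"
  using clusters by (simp add: cluster_partition_def)

lemma card_cluster: "c \<in> C \<Longrightarrow> card c = n"
  using clusters by (simp add: cluster_partition_def)

lemma finite_cluster: "c \<in> C \<Longrightarrow> finite c"
  using card_cluster n_large by (metis card.infinite not_numeral_le_zero)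

lemma cluster_subset: "c \<in> C \<Longrightarrow> c \<subseteq> V"
  using partition_onD1[OF partition] by blast

lemma cluster_unique: "\<lbrakk>c \<in> C; d \<in> C; x \<in> c; x \<in> d\<rbrakk> \<Longrightarrow> c = d"
  using partition by (auto simp: partition_on_def disjoint_def)

lemma other_cluster:
  assumes "c \<in> C"
  obtains d where "d \<in> C" "d \<noteq> c" "V = c \<union> d" "c \<inter> d = {}"
proof -
  have "card C = 2"
    using clusters by (simp add: cluster_partition_def)
  then obtain d where "d \<in> C" "d \<noteq> c" "C = {c, d}"
    using assms by (auto simp: card_2_iff)
  moreover from this have "V = c \<union> d"
    using partition_onD1[OF partition] by auto
  moreover have "c \<inter> d = {}"
    using cluster_unique calculation assms by blast
  ultimately show thesis
    using that by blast
qed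

lemma card_V: "card V = 2 * n"
proof -
  obtain c where "c \<in> C"
    using clusters by (fastforce simp: cluster_partition_def)
  then obtain d where "d \<in> C" "V = c \<union> d" "c \<inter> d = {}"
    using other_cluster by metis
  then show ?thesis
    using \<open>c \<in> C\<close> by (simp add: card_Un_disjoint finite_cluster card_cluster)
qed

lemma pr_bounds: "0 \<le> pr e \<and> pr e \<le> 1"
proof -
  have "0 \<le> q" "q \<le> p"
    using n_large by (auto simp: p_def q_def divide_right_mono)
  moreover have "p \<le> 1"
    using n_large by (simp only: p_def)
  ultimately show ?thesis
    by (auto simp: pr_def)
qed

lemma pr_inside: "\<lbrakk>c \<in> C; x \<in> c; y \<in> c\<rbrakk> \<Longrightarrow> pr {x, y} = p"
  by (auto simp: pr_def)

lemma pr_across: "\<lbrakk>c \<in> C; d \<in> C; c \<noteq> d; x \<in> c; y \<in> d\<rbrakk> \<Longrightarrow> pr {x, y} = q"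
  unfolding pr_def by (metis cluster_unique insert_subset)

lemma pp: "p * p = 9 * (ln (real n))\<^sup>2 / n"
  and qq: "q * q = (ln (real n))\<^sup>2 / n"
  and pq: "p * q = 3 * (ln (real n))\<^sup>2 / n"
  by (simp_all add: p_def q_def power2_eq_square)

lemma mean_inside_own:
  assumes "c \<in> C" "u \<in> c" "v \<in> c" "u \<noteq> v"
  shows "(\<Sum>w\<in>c - {u, v}. pr {u, w} * pr {v, w}) = 9 * (ln (real n))\<^sup>2 * (1 - 2 / n)"
proof -
  have "(\<Sum>w\<in>c - {u, v}. pr {u, w} * pr {v, w}) = (\<Sum>w\<in>c - {u, v}. p * p)"
    using assms by (intro sum.cong) (auto simp: pr_inside)
  also have "\<dots> = (real n - 2) * (p * p)"
    using assms n_large by (simp add: card_Diff_subset card_cluster)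
  finally show ?thesis
    using n_large by (simp add: pp field_simps)
qed

text \<open>The \<open>n - 2\<close> further vertices of the own cluster contribute
  \<open>p * p\<close> each, and the \<open>n\<close> vertices of the other cluster
  \<open>q * q\<close> each.\<close>

lemma mean_inside:
  assumes "c \<in> C" "u \<in> c" "v \<in> c" "u \<noteq> v"
  shows "(\<Sum>w\<in>V - {u, v}. pr {u, w} * pr {v, w}) = (ln (real n))\<^sup>2 * (10 - 18 / n)"
proof -
  obtain d where d: "d \<in> C" "d \<noteq> c" "V = c \<union> d" "c \<inter> d = {}"
    using other_cluster assms(1) by metis
  have "V - {u, v} = (c - {u, v}) \<union> d" "(c - {u, v}) \<inter> d = {}"
    using d assms by blast+
  then have "(\<Sum>w\<in>V - {u, v}. pr {u, w} * pr {v, w})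
      = (\<Sum>w\<in>c - {u, v}. pr {u, w} * pr {v, w}) + (\<Sum>w\<in>d. pr {u, w} * pr {v, w})"
    using d assms by (simp only: sum.union_disjoint finite_cluster finite_Diff)
  also have "(\<Sum>w\<in>d. pr {u, w} * pr {v, w}) = (\<Sum>w\<in>d. q * q)"
    using d assms by (intro sum.cong) (auto simp: pr_across[of c d])
  also have "\<dots> = (ln (real n))\<^sup>2"
    using d n_large by (simp add: card_cluster qq)
  finally show ?thesis
    using assms by (simp add: mean_inside_own algebra_simps)
qed

text \<open>Every \<open>w\<close> shares a cluster with exactly one of \<open>u\<close> and
  \<open>v\<close>, so each of the at most \<open>2 * n\<close> terms is
  \<open>p * q\<close>.\<close>

lemma mean_across:
  assumes "u \<in> V" "v \<in> V" "\<not> same_cluster C u v"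
  shows "(\<Sum>w\<in>V - {u, v}. pr {u, w} * pr {v, w}) \<le> 6 * (ln (real n))\<^sup>2"
proof -
  obtain c where c: "c \<in> C" "u \<in> c"
    using assms partition_onD1[OF partition] by blast
  obtain d where d: "d \<in> C" "d \<noteq> c" "V = c \<union> d" "c \<inter> d = {}"
    using other_cluster c(1) by metis
  have v: "v \<in> d"
    using assms c d by (auto simp: same_cluster_def)
  \<comment> \<open>Including \<open>w = u\<close> and \<open>w = v\<close> keeps the sum uniform:
    \<open>pr\<close> of a singleton is \<open>p\<close>, so these terms are \<open>p * q\<close> as
    well.\<close>
  have "(\<Sum>w\<in>V - {u, v}. pr {u, w} * pr {v, w}) \<le> (\<Sum>w\<in>V. pr {u, w} * pr {v, w})"
    using finite_V pr_bounds by (intro sum_mono2) auto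
  also have "\<dots> = (\<Sum>w\<in>V. p * q)"
  proof (rule sum.cong)
    fix w assume "w \<in> V"
    then consider "w \<in> c" | "w \<in> d"
      using d by blast
    then show "pr {u, w} * pr {v, w} = p * q"
    proof cases
      case 1
      then show ?thesis
        using c d v pr_inside[of c u w] pr_across[of d c v w] by simp
    next
      case 2
      then show ?thesis
        using c d v pr_inside[of d v w] pr_across[of c d u w] by simp
    qed
  qed simp
  also have "\<dots> = 6 * (ln (real n))\<^sup>2"
    using n_large by (simp add: card_V pq)
  finally show ?thesis .
qed

section \<open>Tail bounds for a single pair\<close>

lemma n_inverse: "1 / real n \<le> 1 / 100"
  using n_large by (intro divide_left_mono) auto

text \<open>Chernoff lower tail with \<open>s = 4 / 5\<close>, the ratio of the threshold 8 to the
  leading coefficient 10 of the mean, which is the asymptotically optimal choice.\<close>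

lemma prob_few_common_neighbours_inside:
  assumes "c \<in> C" "u \<in> c" "v \<in> c" "u \<noteq> v"
  shows "measure_pmf.prob M
           {f. real (card (common_neighbours {e. f e} (V - {u, v}) u v)) < 8 * (ln (real n))\<^sup>2} \<le> \<delta>"
proof -
  let ?L = "(ln (real n))\<^sup>2" and ?X = "\<lambda>f. real (card (common_neighbours {e. f e} (V - {u, v}) u v))"
  have uv: "u \<in> V" "v \<in> V"
    using assms cluster_subset by auto
  \<comment> \<open>The estimate 6/25 is sharp enough because 8 * 6/25 = 1.92 stays below the gain
    of 2 from the mean.\<close>
  have ln: "ln (4 / 5 :: real) < 0" "- ln (4 / 5 :: real) \<le> 6 / 25"
  proof -
    show "ln (4 / 5 :: real) < 0" by simp
    have "(5 / 4 :: real) \<le> exp (6 / 25)"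
      using exp_lower_Taylor_quadratic[of "6 / 25 :: real"] by (simp add: power2_eq_square)
    then have "ln (5 / 4 :: real) \<le> ln (exp (6 / 25))"
      by (subst ln_le_cancel_iff) simp_all
    then show "- ln (4 / 5 :: real) \<le> 6 / 25"
      by (simp add: ln_div)
  qed
  have "measure_pmf.prob M {f. ?X f < 8 * ?L}
      \<le> measure_pmf.prob M {f. (8 * ?L) * ln (4 / 5) \<le> ?X f * ln (4 / 5)}"
    using ln by (intro measure_pmf.finite_measure_mono) (auto intro: mult_right_mono_neg)
  also have "\<dots> \<le> exp ((4 / 5 - 1) * (?L * (10 - 18 / n)) - 8 * ?L * ln (4 / 5))"
    using chernoff_common_neighbours[where pr = pr and s = "4 / 5" and a = "8 * ?L",
        OF finite_V uv assms(4) order_refl pr_bounds]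
    by (simp add: mean_inside[OF assms])
  also have "(4 / 5 - 1) * (?L * (10 - 18 / n)) - 8 * ?L * ln (4 / 5)
      = ?L * (- 2 + (18 / 5) * (1 / n) + 8 * (- ln (4 / 5)))"
    by (simp add: algebra_simps)
  \<comment> \<open>Numerically the bracket is at most -2 + 0.036 + 1.92 = -0.044.\<close>
  also have "\<dots> \<le> ?L * (- 1 / 25)"
    using ln n_inverse by (intro mult_left_mono) auto
  finally show ?thesis
    by (simp add: \<delta>_def)
qed

text \<open>Emptiness is the lower tail at \<open>a = 0\<close>. The mean inside the cluster is
  close to 9 times the squared logarithm, so the crude choice \<open>s = 1 / 2\<close> leaves ample
  room.\<close>

lemma prob_no_common_neighbour_inside:
  assumes "c \<in> C" "u \<in> c" "v \<in> c" "u \<noteq> v"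
  shows "measure_pmf.prob M {f. common_neighbours {e. f e} (c - {u, v}) u v = {}} \<le> \<delta>"
proof -
  let ?L = "(ln (real n))\<^sup>2" and ?X = "\<lambda>f. real (card (common_neighbours {e. f e} (c - {u, v}) u v))"
  have uv: "u \<in> V" "v \<in> V" "c - {u, v} \<subseteq> V - {u, v}"
    using assms cluster_subset by auto
  have "measure_pmf.prob M {f. common_neighbours {e. f e} (c - {u, v}) u v = {}}
      \<le> measure_pmf.prob M {f. 0 * ln (1 / 2) \<le> ?X f * ln (1 / 2)}"
    by (intro measure_pmf.finite_measure_mono) auto
  also have "\<dots> \<le> exp ((1 / 2 - 1) * (9 * ?L * (1 - 2 / n)) - 0 * ln (1 / 2))"
    using chernoff_common_neighbours[where pr = pr and s = "1 / 2" and a = 0,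
        OF finite_V uv(1,2) assms(4) uv(3) pr_bounds]
    by (simp add: mean_inside_own[OF assms])
  also have "(1 / 2 - 1) * (9 * ?L * (1 - 2 / n)) - 0 * ln (1 / 2)
      = ?L * (- (9 / 2) + 9 * (1 / n))"
    by (simp add: algebra_simps)
  also have "\<dots> \<le> ?L * (- 1 / 25)"
    using n_inverse by (intro mult_left_mono) auto
  finally show ?thesis
    by (simp add: \<delta>_def)
qed

text \<open>Chernoff upper tail with \<open>s = 4 / 3\<close>, the ratio of the threshold 8 to the
  coefficient 6 bounding the mean.\<close>

lemma prob_many_common_neighbours_across:
  assumes "u \<in> V" "v \<in> V" "\<not> same_cluster C u v"
  shows "measure_pmf.prob M
           {f. 8 * (ln (real n))\<^sup>2 \<le> real (card (common_neighbours {e. f e} (V - {u, v}) u v))} \<le> \<delta>"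
proof -
  let ?L = "(ln (real n))\<^sup>2" and ?X = "\<lambda>f. real (card (common_neighbours {e. f e} (V - {u, v}) u v))"
  have ne: "u \<noteq> v"
    using assms partition_onD1[OF partition] by (auto simp: same_cluster_def)
  \<comment> \<open>Here 8 * 13/50 = 2.08 exceeds (4/3 - 1) * 6 = 2 by 0.08, more than the required
    1/25.\<close>
  have ln: "ln (4 / 3 :: real) \<ge> 13 / 50"
  proof -
    have "exp (13 / 50) \<le> (4 / 3 :: real)"
      using exp_bound[of "13 / 50 :: real"] by (simp add: power2_eq_square)
    then show ?thesis
      by (subst ln_ge_iff) simp_all
  qed
  have "measure_pmf.prob M {f. 8 * ?L \<le> ?X f}
      \<le> measure_pmf.prob M {f. (8 * ?L) * ln (4 / 3) \<le> ?X f * ln (4 / 3)}"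
    using ln by (intro measure_pmf.finite_measure_mono) (auto intro: mult_right_mono)
  also have "\<dots> \<le> exp ((4 / 3 - 1) * (\<Sum>w\<in>V - {u, v}. pr {u, w} * pr {v, w})
                   - 8 * ?L * ln (4 / 3))"
    using chernoff_common_neighbours[where pr = pr and s = "4 / 3" and a = "8 * ?L",
        OF finite_V assms(1,2) ne order_refl pr_bounds]
    by simp
  also have "\<dots> \<le> exp (?L * (2 - 8 * ln (4 / 3)))"
    using mean_across[OF assms] by (simp add: algebra_simps)
  also have "?L * (2 - 8 * ln (4 / 3)) \<le> ?L * (- 1 / 25)"
    using ln by (intro mult_left_mono) auto
  finally show ?thesis
    by (simp add: \<delta>_def)
qed

section \<open>Union bound over all pairs\<close>

text \<open>There are \<open>4 * n * n\<close> ordered pairs of vertices, and each fails with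
  probability at most \<open>2 * \<delta>\<close>: two events for a pair inside a cluster, one for a
  pair across.\<close>

lemma prob_not_well_separated:
  "measure_pmf.prob (planted_partition V C p q) {E. \<not> well_separated V C (8 * (ln (real n))\<^sup>2) E}
     \<le> 8 * (real n)\<^sup>2 * \<delta>"
proof -
  let ?t = "8 * (ln (real n))\<^sup>2"
  let ?N = "\<lambda>f W u v. common_neighbours {e. f e} (W - {u, v}) u v"
  define bad where "bad = (\<lambda>(u, v). {f.
      (\<exists>c\<in>C. u \<in> c \<and> v \<in> c \<and> u \<noteq> v \<and> (real (card (?N f V u v)) < ?t \<or> ?N f c u v = {})) \<or>
      \<not> same_cluster C u v \<and> ?t \<le> real (card (?N f V u v))})"
  have prob_bad: "measure_pmf.prob M (bad (u, v)) \<le> 2 * \<delta>" if uv: "u \<in> V" "v \<in> V" for u v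
  proof -
    have \<delta>: "0 \<le> \<delta>"
      by (simp add: \<delta>_def)
    consider c where "c \<in> C" "u \<in> c" "v \<in> c" "u \<noteq> v" | "u = v" "same_cluster C u v"
      | "\<not> same_cluster C u v"
      by (auto simp: same_cluster_def)
    then show ?thesis
    proof cases
      case 1
      \<comment> \<open>Uniqueness of the cluster of \<open>u\<close> collapses the existential over
        clusters in \<open>bad\<close> to the single \<open>c\<close>.\<close>
      then have "c' = c" if "c' \<in> C" "u \<in> c'" for c'
        using that cluster_unique by blast
      moreover have "same_cluster C u v"
        using 1 by (auto simp: same_cluster_def)
      ultimately have "bad (u, v) \<subseteq> {f. real (card (?N f V u v)) < ?t} \<union> {f. ?N f c u v = {}}"
        unfolding bad_def by blast
      then have "measure_pmf.prob M (bad (u, v))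
          \<le> measure_pmf.prob M ({f. real (card (?N f V u v)) < ?t} \<union> {f. ?N f c u v = {}})"
        by (intro measure_pmf.finite_measure_mono) simp_all
      also have "\<dots> \<le> measure_pmf.prob M {f. real (card (?N f V u v)) < ?t}
          + measure_pmf.prob M {f. ?N f c u v = {}}"
        by (intro measure_Un_le) auto
      also have "\<dots> \<le> \<delta> + \<delta>"
        using 1 by (intro add_mono prob_few_common_neighbours_inside prob_no_common_neighbour_inside)
      finally show ?thesis by simp
    next
      case 2
      then show ?thesis
        using \<delta> by (simp add: bad_def)
    next
      case 3
      then have "bad (u, v) = {f. ?t \<le> real (card (?N f V u v))}"
        by (auto simp: bad_def same_cluster_def)
      then show ?thesis
        using prob_many_common_neighbours_across[OF uv 3] \<delta> by simp
    qed
  qed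
  \<comment> \<open>Restricting to genuine vertex pairs changes nothing, since
    \<open>W - {u, v}\<close> already rules out loops. This links the edge set of the graph with the
    set \<open>{e. f e}\<close> of the tail bounds.\<close>
  have cn: "common_neighbours {e \<in> vertex_pairs V. f e} (W - {u, v}) u v = ?N f W u v"
    if "u \<in> V" "v \<in> V" "W \<subseteq> V" for f W u v
    using that by (auto simp: common_neighbours_def vertex_pairs_def)
  have "measure_pmf.prob (planted_partition V C p q) {E. \<not> well_separated V C ?t E}
      = measure_pmf.prob M {f. \<not> well_separated V C ?t {e \<in> vertex_pairs V. f e}}"
    by (simp add: planted_partition_def pr_def vimage_def)
  also have "\<dots> \<le> measure_pmf.prob M (\<Union>x\<in>V \<times> V. bad x)"
  proof (intro measure_pmf.finite_measure_mono subsetI)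
    fix f assume "f \<in> {f. \<not> well_separated V C ?t {e \<in> vertex_pairs V. f e}}"
    then consider c u v where "c \<in> C" "u \<in> c" "v \<in> c" "u \<noteq> v"
        "real (card (common_neighbours {e \<in> vertex_pairs V. f e} (V - {u, v}) u v)) < ?t \<or>
         common_neighbours {e \<in> vertex_pairs V. f e} (c - {u, v}) u v = {}"
      | u v where "u \<in> V" "v \<in> V" "\<not> same_cluster C u v"
        "?t \<le> real (card (common_neighbours {e \<in> vertex_pairs V. f e} (V - {u, v}) u v))"
      unfolding well_separated_def mem_Collect_eq by (meson not_le)
    then have "\<exists>u\<in>V. \<exists>v\<in>V. f \<in> bad (u, v)"
    proof cases
      case 1
      then have "u \<in> V" "v \<in> V" "c \<subseteq> V"
        using cluster_subset by auto
      then have "f \<in> bad (u, v)"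
        using 1 by (auto simp: bad_def cn)
      then show ?thesis
        using \<open>u \<in> V\<close> \<open>v \<in> V\<close> by blast
    next
      case 2
      then have "f \<in> bad (u, v)"
        by (auto simp: bad_def cn)
      then show ?thesis
        using 2 by blast
    qed
    then show "f \<in> (\<Union>x\<in>V \<times> V. bad x)"
      by blast
  qed auto
  also have "\<dots> \<le> (\<Sum>x\<in>V \<times> V. measure_pmf.prob M (bad x))"
    using finite_V by (intro measure_pmf.finite_measure_subadditive_finite) auto
  also have "\<dots> \<le> (\<Sum>x\<in>V \<times> V. 2 * \<delta>)"
    using prob_bad by (intro sum_mono) auto
  also have "\<dots> = 8 * (real n)\<^sup>2 * \<delta>"
    by (simp add: card_cartesian_product card_V power2_eq_square)
  finally show ?thesis .
qed

end

section \<open>Passage to the limit\<close>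

theorem mainTheorem2:
  fixes V :: "nat \<Rightarrow> 'a set" and C :: "nat \<Rightarrow> 'a set set"
  assumes "\<And>n. n \<ge> 1 \<Longrightarrow> cluster_partition n 2 (V n) (C n)"
  shows "(\<lambda>n. measure_pmf.prob
            (planted_partition (V n) (C n) (3 * ln (real n) / sqrt (real n)) (ln (real n) / sqrt (real n)))
            {E. (\<forall>u v. {u, v} \<in> E \<and> same_cluster (C n) u v \<longrightarrow>
                   real (triangle_count E u v) \<ge> 8 * (ln (real n))\<^sup>2) \<and>
                (\<forall>u v. {u, v} \<in> E \<and> \<not> same_cluster (C n) u v \<longrightarrow>
                   real (triangle_count E u v) \<le> 8 * (ln (real n))\<^sup>2) \<and>
                connected_components (V n)
                  (E - {{u, v} | u v. {u, v} \<in> E \<and>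
                          real (triangle_count E u v) < 8 * (ln (real n))\<^sup>2}) = C n})
         \<longlonglongrightarrow> 1"
proof -
  define P where "P n = planted_partition (V n) (C n)
    (3 * ln (real n) / sqrt (real n)) (ln (real n) / sqrt (real n))" for n
  define G where "G n = {E.
      (\<forall>u v. {u, v} \<in> E \<and> same_cluster (C n) u v \<longrightarrow>
         real (triangle_count E u v) \<ge> 8 * (ln (real n))\<^sup>2) \<and>
      (\<forall>u v. {u, v} \<in> E \<and> \<not> same_cluster (C n) u v \<longrightarrow>
         real (triangle_count E u v) \<le> 8 * (ln (real n))\<^sup>2) \<and>
      connected_components (V n)
        (E - {{u, v} | u v. {u, v} \<in> E \<and>
           real (triangle_count E u v) < 8 * (ln (real n))\<^sup>2}) = C n}" for n
  have "eventually (\<lambda>n::nat. 3 * ln (real n) / sqrt (real n) \<le> 1) at_top"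
    by real_asymp
  \<comment> \<open>This is the lower half of a sandwich; the locale assumptions hold only from some
    \<open>n\<close> on.\<close>
  then have "eventually (\<lambda>n. 1 - 8 * (real n)\<^sup>2 * exp (- (ln (real n))\<^sup>2 / 25)
      \<le> measure_pmf.prob (P n) (G n)) at_top"
    using eventually_ge_at_top[of 100]
  proof eventually_elim
    case (elim n)
    then interpret planted_bisection n "V n" "C n"
      using assms[of n] by unfold_locales auto
    have good: "E \<in> G n" if "E \<subseteq> vertex_pairs (V n)"
        "well_separated (V n) (C n) (8 * (ln (real n))\<^sup>2) E" for E
    proof -
      have "8 * (ln (real n))\<^sup>2 \<le> real (triangle_count E u v) \<longleftrightarrow> same_cluster (C n) u v"
        if "{u, v} \<in> E" for u v
        using triangle_count_of_well_separated \<open>E \<subseteq> _\<close> \<open>well_separated _ _ _ E\<close> that .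
      moreover have "connected_components (V n)
        (E - {{u, v} | u v. {u, v} \<in> E \<and>
           real (triangle_count E u v) < 8 * (ln (real n))\<^sup>2}) = C n"
        using connected_components_of_well_separated partition that .
      ultimately show ?thesis
        unfolding G_def mem_Collect_eq by (meson linear)
    qed
    define B where "B = {E. \<not> well_separated (V n) (C n) (8 * (ln (real n))\<^sup>2) E}"
    have "E \<subseteq> vertex_pairs (V n)" if "E \<in> set_pmf (P n)" for E
      using that by (auto simp: P_def planted_partition_def)
    \<comment> \<open>Separation yields the desired conclusions only for sets of vertex pairs, so
      the inclusion is used almost surely, on the support of \<open>P n\<close>.\<close>
    then have "AE E in P n. E \<in> UNIV - B \<longrightarrow> E \<in> G n"
      using good by (auto simp: AE_measure_pmf_iff B_def)
    then have "measure_pmf.prob (P n) (UNIV - B) \<le> measure_pmf.prob (P n) (G n)"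
      by (intro measure_pmf.finite_measure_mono_AE) simp_all
    moreover have "measure_pmf.prob (P n) (UNIV - B) = 1 - measure_pmf.prob (P n) B"
      using measure_pmf.prob_compl[of B "P n"] by simp
    moreover have "measure_pmf.prob (P n) B \<le> 8 * (real n)\<^sup>2 * \<delta>"
      using prob_not_well_separated unfolding P_def B_def p_def q_def .
    ultimately show ?case
      by (simp add: \<delta>_def)
  qed
  moreover have "eventually (\<lambda>n. measure_pmf.prob (P n) (G n) \<le> 1) at_top"
    by simp
  \<comment> \<open>The error is 8 exp(2 ln n - (ln n)^2 / 25), whose exponent tends to minus
    infinity.\<close>
  moreover have "(\<lambda>n::nat. 1 - 8 * (real n)\<^sup>2 * exp (- (ln (real n))\<^sup>2 / 25)) \<longlonglongrightarrow> 1"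
    by real_asymp
  ultimately have "(\<lambda>n. measure_pmf.prob (P n) (G n)) \<longlonglongrightarrow> 1"
    by (rule tendsto_sandwich[OF _ _ _ tendsto_const])
  then show ?thesis
    by (simp only: P_def G_def)
qed

end
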